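(* Computing a connected $\epsilon$-envy-free allocation for three players requires $\Omega(\log\frac1\epsilon)$ queries in the Robertson–Webb (RW) model. That is, there are constants $c>0$ and $\epsilon_0\in(0,1)$ such that for every $0<\epsilon<\epsilon_0$, every deterministic RW protocol that outputs a connected $\epsilon$-envy-free allocation for every choice of value densities $v_1,v_2,v_3$ asks at least $c\log\frac1\epsilon$ queries on some instance.
   Context: Cake cutting model. The cake is $[0,1]$ and the players are $N=\{1,\dots,n\}$ (here $n=3$). Player $i$ has a private non-negative integrable value density $v_i$ on $[0,1]$ with $\int_0^1 v_i=1$, and values a measurable set $S$ at $V_i(S)=\int_S v_i(x)\,dx$. A piece is a finite union of disjoint intervals (shared endpoints are irrelevant, since sets of measure zero are worth zero); it is connected if it is a single interval. An allocation $A=(A_1,\dots,A_n)$ is a partition of $[0,1]$ into pieces, player $i$ receiving $A_i$. It is connected if every $A_i$ is connected, and $\epsilon$-envy-free if $V_i(A_i)\ge V_i(A_j)-\epsilon$ for all $i,j$. RW model. A protocol, not knowing the densities, adaptively asks the players queries of two types: $\mathrm{Cut}_i(\alpha)$, for any $\alpha\in[0,1]$: player $i$ returns a point $y$ with $V_i([0,y])=\alpha$ (ties resolved deterministically, e.g. the leftmost such point), and $y$ becomes a cut point; $\mathrm{Eval}_i(y)$, for a previously made cut point $y$: player $i$ returns $V_i([0,y])$. At the end the protocol outputs an allocation demarcated by cut points discovered through its queries. Protocols are deterministic and the number of queries is counted in the worst case over instances. *)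

theory Defs
  imports "HOL-Analysis.Analysis"
begin

section \<open>Valuations and allocations of the cake [0,1]\<close>

definition value_density :: "(real \<Rightarrow> real) \<Rightarrow> bool" where
  "value_density v \<longleftrightarrow>
     (\<forall>x\<in>{0..1}. 0 \<le> v x) \<and>
     set_integrable lebesgue {0..1} v \<and>
     (LINT x:{0..1}|lebesgue. v x) = 1"

definition val :: "(real \<Rightarrow> real) \<Rightarrow> real set \<Rightarrow> real" where
  "val v S = (LINT x:S|lebesgue. v x)"

definition piece :: "real set \<Rightarrow> bool" where
  "piece S \<longleftrightarrow>
     S \<subseteq> {0..1} \<and> (\<exists>F. finite F \<and> (\<forall>I\<in>F. is_interval I) \<and> disjoint F \<and> S = \<Union>F)"

text \<open>Pieces may share endpoints: two pieces intersect in a negligible set iff they have only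
  finitely many points in common. Both closed intervals with common endpoints and genuinely
  disjoint (half-open) intervals are therefore admitted.\<close>

definition allocation :: "('p \<Rightarrow> real set) \<Rightarrow> bool" where
  "allocation A \<longleftrightarrow>
     (\<forall>i. piece (A i)) \<and> (\<Union>i. A i) = {0..1} \<and>
     (\<forall>i j. i \<noteq> j \<longrightarrow> negligible (A i \<inter> A j))"

definition connected_allocation :: "('p \<Rightarrow> real set) \<Rightarrow> bool" where
  "connected_allocation A \<longleftrightarrow> allocation A \<and> (\<forall>i. is_interval (A i))"

definition envy_free_upto :: "real \<Rightarrow> ('p \<Rightarrow> real \<Rightarrow> real) \<Rightarrow> ('p \<Rightarrow> real set) \<Rightarrow> bool" where
  "envy_free_upto \<epsilon> v A \<longleftrightarrow> (\<forall>i j. val (v i) (A i) \<ge> val (v i) (A j) - \<epsilon>)"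

section \<open>The Robertson--Webb query model\<close>

datatype 'p query = Cut 'p real | Eval 'p real

datatype 'p action = Ask "'p query" | Output "'p \<Rightarrow> real set"

text \<open>A history lists the queries asked so far, oldest first, each with the answer received. A
  deterministic protocol sees the densities only through the history.\<close>

type_synonym 'p history = "('p query \<times> real) list"

type_synonym 'p protocol = "'p history \<Rightarrow> 'p action"

text \<open>A cut rule says which point player \<open>i\<close> with density \<open>v\<close> returns on \<open>Cut i \<alpha>\<close>.
  It is a function, so ties are resolved deterministically, but it is otherwise arbitrary.\<close>

type_synonym 'p cut_rule = "'p \<Rightarrow> (real \<Rightarrow> real) \<Rightarrow> real \<Rightarrow> real"

definition valid_cut_rule :: "'p cut_rule \<Rightarrow> bool" where
  "valid_cut_rule \<tau> \<longleftrightarrow>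
     (\<forall>i v. value_density v \<longrightarrow>
        (\<forall>\<alpha>\<in>{0..1}. \<tau> i v \<alpha> \<in> {0..1} \<and> val v {0..\<tau> i v \<alpha>} = \<alpha>))"

fun answer :: "'p cut_rule \<Rightarrow> ('p \<Rightarrow> real \<Rightarrow> real) \<Rightarrow> 'p query \<Rightarrow> real" where
  "answer \<tau> v (Cut i \<alpha>) = \<tau> i (v i) \<alpha>"
| "answer \<tau> v (Eval i y) = val (v i) {0..y}"

definition cut_points :: "'p history \<Rightarrow> real set" where
  "cut_points h = {y. \<exists>i \<alpha>. (Cut i \<alpha>, y) \<in> set h}"

fun legal_query :: "'p history \<Rightarrow> 'p query \<Rightarrow> bool" where
  "legal_query h (Cut i \<alpha>) \<longleftrightarrow> \<alpha> \<in> {0..1}"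
| "legal_query h (Eval i y) \<longleftrightarrow> y \<in> cut_points h"

text \<open>The ends 0 and 1 of the cake may bound pieces without having been discovered by a query.\<close>

definition demarcated :: "'p history \<Rightarrow> ('p \<Rightarrow> real set) \<Rightarrow> bool" where
  "demarcated h A \<longleftrightarrow> (\<forall>i. frontier (A i) \<subseteq> cut_points h \<union> {0, 1})"

inductive reaches :: "'p cut_rule \<Rightarrow> 'p protocol \<Rightarrow> ('p \<Rightarrow> real \<Rightarrow> real) \<Rightarrow> 'p history \<Rightarrow> bool"
  for \<tau> P v where
  start: "reaches \<tau> P v []"
| ask: "reaches \<tau> P v h \<Longrightarrow> P h = Ask q \<Longrightarrow> reaches \<tau> P v (h @ [(q, answer \<tau> v q)])"

text \<open>\<open>execution \<tau> P v h A\<close>: on the densities \<open>v\<close> the protocol halts with output \<open>A\<close> after the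
  complete history \<open>h\<close>, hence after \<open>length h\<close> queries.\<close>

definition execution ::
  "'p cut_rule \<Rightarrow> 'p protocol \<Rightarrow> ('p \<Rightarrow> real \<Rightarrow> real) \<Rightarrow> 'p history \<Rightarrow> ('p \<Rightarrow> real set) \<Rightarrow> bool" where
  "execution \<tau> P v h A \<longleftrightarrow> reaches \<tau> P v h \<and> P h = Output A"

definition rw_protocol :: "'p cut_rule \<Rightarrow> 'p protocol \<Rightarrow> bool" where
  "rw_protocol \<tau> P \<longleftrightarrow>
     (\<forall>v. (\<forall>i. value_density (v i)) \<longrightarrow>
        (\<forall>h q. reaches \<tau> P v h \<longrightarrow> P h = Ask q \<longrightarrow> legal_query h q) \<and>
        (\<exists>h A. execution \<tau> P v h A \<and> allocation A \<and> demarcated h A))"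

lemma reaches_append:
  assumes "reaches \<tau> P v (h @ g)"
  shows "reaches \<tau> P v h \<and> (g \<noteq> [] \<longrightarrow> (\<exists>q. P h = Ask q \<and> hd g = (q, answer \<tau> v q)))"
  using assms
proof (induction g rule: rev_induct)
  case (snoc x g)
  from snoc.prems obtain q where q: "reaches \<tau> P v (h @ g)" "P (h @ g) = Ask q"
      "x = (q, answer \<tau> v q)"
    by (cases rule: reaches.cases) auto
  with snoc.IH show ?case by (cases g) auto
qed simp

lemma execution_unique:
  assumes "execution \<tau> P v h A" "execution \<tau> P v h' A'"
  shows "h' = h \<and> A' = A"
proof -
  have prefix: "\<exists>g. k = h @ g" if "reaches \<tau> P v k" "P k = Output B" "reaches \<tau> P v h" for k h B
    using that(3)
  proof (induction rule: reaches.induct)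
    case (ask h q)
    then obtain g where g: "k = h @ g" by blast
    with ask.hyps that(2) have "g \<noteq> []" by auto
    with reaches_append[of \<tau> P v h g] that(1) ask.hyps g
    have "hd g = (q, answer \<tau> v q)" by auto
    with g \<open>g \<noteq> []\<close> have "k = (h @ [(q, answer \<tau> v q)]) @ tl g" by (cases g) auto
    then show ?case by blast
  qed simp
  from assms prefix[of h' A' h] prefix[of h A h'] have "h' = h"
    by (auto simp: execution_def)
  with assms show ?thesis by (simp add: execution_def)
qed

text \<open>Resolving ties by the leftmost point is an admissible cut rule.\<close>

lemma valid_leftmost_cut:
  "valid_cut_rule (\<lambda>i v \<alpha>. Inf {y \<in> {0..1}. val v {0..y} = \<alpha>})"
  unfolding valid_cut_rule_def
proof (intro allI impI ballI)
  fix v :: "real \<Rightarrow> real" and \<alpha> :: real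
  assume v: "value_density v" and \<alpha>: "\<alpha> \<in> {0..1}"
  let ?S = "{y \<in> {0..1}. val v {0..y} = \<alpha>}"
  have int: "set_integrable lebesgue {0..y} v" if "y \<le> 1" for y
    using v that by (auto simp: value_density_def intro: set_integrable_subset)
  have eq: "val v {0..y} = integral {0..y} v" if "y \<le> 1" for y
    unfolding val_def using set_lebesgue_integral_eq_integral(2)[OF int[OF that]] .
  have "v integrable_on {0..1}"
    using set_lebesgue_integral_eq_integral(1)[OF int[of 1]] by simp
  then have "continuous_on {0..1} (\<lambda>y. integral {0..y} v)"
    by (rule indefinite_integral_continuous_1)
  then have cont: "continuous_on {0..1} (\<lambda>y. val v {0..y})"
    by (rule continuous_on_eq) (simp add: eq)
  have "val v {0..0} = 0" "val v {0..1} = 1"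
    using v eq[of 0] by (auto simp: val_def value_density_def)
  then have "\<exists>y. 0 \<le> y \<and> y \<le> 1 \<and> val v {0..y} = \<alpha>"
    using \<alpha> cont by (intro IVT') auto
  then have ne: "?S \<noteq> {}" by auto
  have cl: "closed ?S"
    using continuous_closed_preimage_constant[OF cont, of \<alpha>] by simp
  have bb: "bdd_below ?S"
    by (rule bdd_belowI[of _ 0]) simp
  have "Inf ?S \<in> ?S"
    by (rule closed_contains_Inf[OF ne bb cl])
  then show "Inf ?S \<in> {0..1} \<and> val v {0..Inf ?S} = \<alpha>"
    by (simp only: mem_Collect_eq)
qed

end

theory Submission
  imports Defs
begin

text \<open>Player 1 has a density \<open>f\<close> with distribution function \<open>F\<close>, player 2 the mirrored density
  \<open>f (1 - x)\<close>, and player 3 is uniform. For suitable \<open>F\<close>, envy-freeness up to \<open>\<epsilon>\<close> forces a cut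
  point \<open>p\<close> with \<open>2 F p - F (1 - p) = O(\<epsilon>)\<close>, and thereby locates a hidden zero \<open>p = 1 - c\<close> up to
  \<open>O(\<epsilon>)\<close>. The adversary keeps \<open>F\<close> linear on a window of radius \<open>r\<close> around \<open>c\<close>. A query reveals a
  single point of the graph of \<open>F\<close> or of its mirror image, so among two candidate windows of radius
  \<open>r / 15\<close>, whose domains and images are both disjoint, one is missed by it; the answers given so far
  survive a modification of \<open>F\<close> inside the old window. Each query thus costs only a factor 15.\<close>

section \<open>Densities with strictly increasing distribution functions\<close>

text \<open>The lower bound 9/16 makes \<open>F\<close> strictly increasing on [0,1], so each Cut
  query has exactly one correct answer and ties never occur, whatever the cut rule.\<close>

definition has_cdf :: "(real \<Rightarrow> real) \<Rightarrow> (real \<Rightarrow> real) \<Rightarrow> bool" where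
  "has_cdf v F \<longleftrightarrow> (\<forall>x\<in>{0..1}. 9/16 \<le> v x) \<and>
     (\<forall>x\<in>{0..1}. (v has_integral F x) {0..x}) \<and> F 1 = 1"

lemma has_cdf_lower: "has_cdf v F \<Longrightarrow> 0 \<le> x \<Longrightarrow> x \<le> 1 \<Longrightarrow> 9/16 \<le> v x"
  and has_cdf_integral: "has_cdf v F \<Longrightarrow> 0 \<le> x \<Longrightarrow> x \<le> 1 \<Longrightarrow> (v has_integral F x) {0..x}"
  and has_cdf_at_1: "has_cdf v F \<Longrightarrow> F 1 = 1"
  unfolding has_cdf_def by simp_all

lemma has_cdf_has_integral:
  assumes "has_cdf v F" "0 \<le> x" "x \<le> y" "y \<le> 1"
  shows "(v has_integral (F y - F x)) {x..y}"
proof -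
  have x: "(v has_integral F x) {0..x}" and y: "(v has_integral F y) {0..y}"
    using has_cdf_integral[OF assms(1)] assms(2-) by simp_all
  have "v integrable_on {0..y}" using y by blast
  then have "v integrable_on {x..y}"
    by (rule integrable_on_subinterval) (use assms in auto)
  moreover have "integral {0..x} v + integral {x..y} v = integral {0..y} v"
    using \<open>v integrable_on {0..y}\<close> assms
    by (intro Henstock_Kurzweil_Integration.integral_combine) auto
  ultimately show ?thesis
    using x y by (simp add: has_integral_integrable_integral)
qed

lemma has_cdf_at_0:
  assumes "has_cdf v F"
  shows "F 0 = 0"
proof (rule has_integral_unique)
  show "(v has_integral F 0) {0..0}" using has_cdf_integral[OF assms, of 0] by simp
  show "(v has_integral 0) {0..0}" using has_integral_refl(2)[of v 0] by simp
qed

lemma has_cdf_increment: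
  assumes "has_cdf v F" "0 \<le> x" "x \<le> y" "y \<le> 1"
  shows "9/16 * (y - x) \<le> F y - F x"
proof (rule has_integral_le)
  show "((\<lambda>_. 9/16) has_integral 9/16 * (y - x)) {x..y}"
    using has_integral_const_real[of "9/16::real" x y] assms by (simp add: mult.commute)
  show "(v has_integral F y - F x) {x..y}" by (rule has_cdf_has_integral[OF assms])
  show "9/16 \<le> v z" if "z \<in> {x..y}" for z
    using that assms(2-) by (intro has_cdf_lower[OF assms(1)]) auto
qed

lemma has_cdf_set_integrable:
  assumes "has_cdf v F"
  shows "set_integrable lebesgue {0..1} v"
proof (rule nonnegative_absolutely_integrable_1)
  show "v integrable_on {0..1}" using has_cdf_integral[OF assms, of 1] by auto
  show "0 \<le> v x" if "x \<in> {0..1}" for x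
    using has_cdf_lower[OF assms, of x] that by simp
qed

text \<open>Pieces may contain or omit their endpoints, hence the sandwich. \<open>S\<close> is an
  open interval plus at most two points, so it is measurable and its Lebesgue integral agrees with
  the gauge integral over \<open>{p..q}\<close>.\<close>

lemma val_between:
  assumes v: "has_cdf v F" and pq: "0 \<le> p" "p \<le> q" "q \<le> 1"
    and S: "{p<..<q} \<subseteq> S" "S \<subseteq> {p..q}"
  shows "val v S = F q - F p"
proof -
  have "S = {p<..<q} \<union> (S \<inter> {p, q})" using S by force
  moreover have "{p<..<q} \<union> (S \<inter> {p, q}) \<in> sets lebesgue"
    by (intro sets.Un) (auto intro: negligible_imp_sets negligible_finite)
  ultimately have "S \<in> sets lebesgue" by simp
  then have "set_integrable lebesgue S v"
    using S pq by (intro set_integrable_subset[OF has_cdf_set_integrable[OF v]]) auto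
  then have "val v S = integral S v"
    unfolding val_def by (rule set_lebesgue_integral_eq_integral(2))
  also have "\<dots> = integral {p..q} v"
  proof (rule integral_spike_set)
    have "{x \<in> S - {p..q}. v x \<noteq> 0} = {}" using S by auto
    then show "negligible {x \<in> S - {p..q}. v x \<noteq> 0}" by (simp only: negligible_empty)
    have "{x \<in> {p..q} - S. v x \<noteq> 0} \<subseteq> {p, q}" using S by force
    then show "negligible {x \<in> {p..q} - S. v x \<noteq> 0}"
      by (rule negligible_subset[rotated]) simp
  qed
  also have "\<dots> = F q - F p"
    using has_cdf_has_integral[OF v pq] by (rule integral_unique)
  finally show ?thesis .
qed

lemma has_cdf_value_density:
  assumes "has_cdf v F"
  shows "value_density v"
  unfolding value_density_def
proof (intro conjI ballI)
  show "0 \<le> v x" if "x \<in> {0..1}" for x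
    using has_cdf_lower[OF assms, of x] that by simp
  show "set_integrable lebesgue {0..1} v" by (rule has_cdf_set_integrable[OF assms])
  have "val v {0..1} = F 1 - F 0" by (rule val_between[OF assms]) auto
  then show "(LINT x:{0..1}|lebesgue. v x) = 1"
    using has_cdf_at_1[OF assms] has_cdf_at_0[OF assms] by (simp add: val_def)
qed

lemma has_cdf_mirror:
  assumes "has_cdf v F"
  shows "has_cdf (\<lambda>x. v (1 - x)) (\<lambda>x. 1 - F (1 - x))"
  unfolding has_cdf_def
proof (intro conjI ballI)
  fix x :: real assume x: "x \<in> {0..1}"
  then show "9/16 \<le> v (1 - x)" using has_cdf_lower[OF assms, of "1 - x"] by simp
  have "(v has_integral (F 1 - F (1 - x))) {1 - x..1}"
    using x by (intro has_cdf_has_integral[OF assms]) auto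
  then have "(v has_integral (1 - F (1 - x))) {1 - x..1}"
    using has_cdf_at_1[OF assms] by simp
  from has_integral_affinity[OF this[folded cbox_interval], of "-1" 1]
  have "((\<lambda>x. v (1 - x)) has_integral (1 - F (1 - x))) ((\<lambda>x. 1 - x) ` {1 - x..1})"
    by (simp add: algebra_simps)
  moreover have "(\<lambda>x. 1 - x) ` {1 - x..1} = {0..x}" by force
  ultimately show "((\<lambda>x. v (1 - x)) has_integral (1 - F (1 - x))) {0..x}" by simp
qed (simp add: has_cdf_at_0[OF assms])

lemma has_cdf_uniform: "has_cdf (\<lambda>_. 1) (\<lambda>x. x)"
proof -
  have "((\<lambda>_. 1) has_integral x) {0..x}" if "0 \<le> x" for x :: real
    using that has_integral_const_real[of "1::real" 0 x] by simp
  then show ?thesis unfolding has_cdf_def by simp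
qed

text \<open>The hidden densities arise from a constant by adding multiples of such steps, and their
  distribution functions by adding the terms \<open>min x p\<close>.\<close>

lemma has_integral_step:
  fixes p x :: real
  assumes "0 \<le> p" "0 \<le> x"
  shows "((\<lambda>z. of_bool (z \<le> p)) has_integral min x p) {0..x}"
proof -
  have "((\<lambda>z. 1::real) has_integral min x p) {0..min x p}"
    using has_integral_const_real[of "1::real" 0 "min x p"] assms by simp
  then have "((\<lambda>z. of_bool (z \<le> p) :: real) has_integral min x p) {0..min x p}"
    by (rule has_integral_eq[rotated]) auto
  moreover have "((\<lambda>z. of_bool (z \<le> p) :: real) has_integral 0) {min x p..x}"
  proof (rule has_integral_spike_finite[of "{x, p}" _ _ "\<lambda>_. 0"])
    show "of_bool (z \<le> p) = (0::real)" if "z \<in> {min x p..x} - {x, p}" for z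
      using that by (auto simp: min_def split: if_splits)
  qed auto
  ultimately have "((\<lambda>z. of_bool (z \<le> p) :: real) has_integral (min x p + 0)) {0..x}"
    using assms by (intro has_integral_combine[of 0 "min x p" x]) auto
  then show ?thesis by simp
qed

section \<open>The hidden instance\<close>

definition players :: "(real \<Rightarrow> real) \<Rightarrow> 3 \<Rightarrow> real \<Rightarrow> real" where
  "players f i = (if i = 1 then f else if i = 2 then (\<lambda>x. f (1 - x)) else (\<lambda>_. 1))"

definition players_cdf :: "(real \<Rightarrow> real) \<Rightarrow> 3 \<Rightarrow> real \<Rightarrow> real" where
  "players_cdf F i = (if i = 1 then F else if i = 2 then (\<lambda>x. 1 - F (1 - x)) else (\<lambda>x. x))"

text \<open>A query to player 2 at \<open>y\<close> exposes \<open>F\<close> at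
  \<open>1 - y\<close>; hence the mirror image of the interval around \<open>c\<close> belongs to
  the window.\<close>

definition window :: "real \<Rightarrow> real \<Rightarrow> real set" where
  "window c r = {x. \<bar>x - c\<bar> < r \<or> \<bar>x - (1 - c)\<bar> < r}"

text \<open>Data shared by all instances. Only the stretch from 29/48 to 31/48 is left free; its
  mirror image, from 17/48 to 19/48, lies where \<open>F\<close> is the fixed line
  \<open>3/2 * x - 3/16\<close>. The bounds 15/16 and 9/4 are 3/2 lowered by 9/16 and raised by 3/4,
  the changes made in \<open>hidden_shift\<close>.\<close>

definition profile :: "(real \<Rightarrow> real) \<Rightarrow> (real \<Rightarrow> real) \<Rightarrow> real \<Rightarrow> bool" where
  "profile f F x \<longleftrightarrow>
     (x \<le> 1/3 \<longrightarrow> f x = 15/16) \<and> (1/3 < x \<longrightarrow> x \<le> 29/48 \<longrightarrow> f x = 3/2) \<and>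
     (29/48 < x \<longrightarrow> x \<le> 31/48 \<longrightarrow> 15/16 \<le> f x \<and> f x \<le> 9/4) \<and>
     (31/48 < x \<longrightarrow> x \<le> 2/3 \<longrightarrow> f x = 3/2) \<and> (2/3 < x \<longrightarrow> f x = 9/16) \<and>
     (0 \<le> x \<longrightarrow> x \<le> 1/3 \<longrightarrow> F x = 15/16 * x) \<and>
     (1/3 \<le> x \<longrightarrow> x \<le> 29/48 \<longrightarrow> F x = 3/2 * x - 3/16) \<and>
     (31/48 \<le> x \<longrightarrow> x \<le> 2/3 \<longrightarrow> F x = 3/2 * x - 3/16)"

text \<open>The line on the window makes \<open>F c = 2 * F (1 - c)\<close>, as \<open>F x = 3/2 * x - 3/16\<close> near \<open>1 - c\<close>.\<close>

definition hidden :: "(real \<Rightarrow> real) \<Rightarrow> (real \<Rightarrow> real) \<Rightarrow> real \<Rightarrow> real \<Rightarrow> bool" where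
  "hidden f F c r \<longleftrightarrow> 0 < r \<and> 29/48 \<le> c - r \<and> c + r \<le> 31/48 \<and> has_cdf f F \<and>
     (\<forall>x. profile f F x) \<and>
     (\<forall>x. c - r < x \<and> x \<le> c + r \<longrightarrow> f x = 3/2) \<and>
     (\<forall>x. \<bar>x - c\<bar> \<le> r \<longrightarrow> F x = 21/8 - 3 * c + 3/2 * (x - c))"

lemma hiddenD:
  assumes "hidden f F c r"
  shows "0 < r" "29/48 \<le> c - r" "c + r \<le> 31/48" "has_cdf f F" "profile f F x"
    and "c - r < x \<Longrightarrow> x \<le> c + r \<Longrightarrow> f x = 3/2"
    and "\<bar>x - c\<bar> \<le> r \<Longrightarrow> F x = 21/8 - 3 * c + 3/2 * (x - c)"
  using assms unfolding hidden_def by blast+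

lemma has_cdf_players:
  assumes "hidden f F c r"
  shows "has_cdf (players f i) (players_cdf F i)"
  using hiddenD(4)[OF assms] has_cdf_mirror[of f F] has_cdf_uniform
  by (simp add: players_def players_cdf_def)

lemma has_cdf_inj:
  assumes "has_cdf v F" "x \<in> {0..1}" "y \<in> {0..1}" "F x = F y"
  shows "x = y"
proof (rule ccontr)
  assume "x \<noteq> y"
  then consider "x < y" | "y < x" by linarith
  then show False
  proof cases
    case 1
    then have "9/16 * (y - x) \<le> F y - F x" using assms by (intro has_cdf_increment) auto
    with 1 assms(4) show False by argo
  next
    case 2
    then have "9/16 * (x - y) \<le> F x - F y" using assms by (intro has_cdf_increment) auto
    with 2 assms(4) show False by argo
  qed
qed

text \<open>At \<open>c = 5/8\<close> the line prescribed on the window coincides with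
  \<open>3/2 * x - 3/16\<close>, so density 3/2 throughout the middle third will do.\<close>

lemma hidden_initial: "\<exists>f F. hidden f F (5/8) (1/48)"
proof (intro exI)
  let ?f = "\<lambda>x::real. 9/16 + 15/16 * of_bool (x \<le> 2/3) - 9/16 * of_bool (x \<le> 1/3) :: real"
  let ?F = "\<lambda>x::real. 9/16 * x + 15/16 * min x (2/3) - 9/16 * min x (1/3)"
  have "((\<lambda>_. 9/16) has_integral 9/16 * x) {0..x}" if "0 \<le> x" for x :: real
    using that has_integral_const_real[of "9/16::real" 0 x] by (simp add: mult.commute)
  then have "(?f has_integral ?F x) {0..x}" if "0 \<le> x" for x
    using that
    by (intro has_integral_add has_integral_diff has_integral_mult_right has_integral_step) simp_all
  then have "has_cdf ?f ?F" unfolding has_cdf_def by simp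
  moreover have "profile ?f ?F x" for x unfolding profile_def by (simp add: min_def)
  moreover have "?f x = 3/2" if "5/8 - 1/48 < x \<and> x \<le> 5/8 + 1/48" for x
    using that by simp
  moreover have "?F x = 21/8 - 3 * (5/8) + 3/2 * (x - 5/8)" if "\<bar>x - 5/8\<bar> \<le> 1/48" for x
  proof -
    have "29/48 \<le> x" "x \<le> 31/48" using that unfolding abs_le_iff by linarith+
    then show ?thesis by (simp add: min_def field_simps)
  qed
  ultimately show "hidden ?f ?F (5/8) (1/48)"
    unfolding hidden_def by (intro conjI allI impI) simp_all
qed

lemma hidden_narrow:
  assumes "hidden f F c r"
  shows "hidden f F c (r / 15)"
proof -
  note h = hiddenD[OF assms]
  have "f x = 3/2" if "c - r/15 < x" "x \<le> c + r/15" for x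
    using h(6)[of x] h(1) that by simp
  moreover have "F x = 21/8 - 3 * c + 3/2 * (x - c)" if "\<bar>x - c\<bar> \<le> r/15" for x
    using h(7)[of x] h(1) that by simp
  ultimately show ?thesis
    using h(1-5) unfolding hidden_def by (intro conjI allI impI) simp_all
qed

text \<open>Moving the centre by \<open>2 * r / 15\<close> lowers the line that \<open>F\<close> follows on the window by
  \<open>9/2 * (2 * r / 15) = 3/5 * r\<close>. The slope changes \<open>-9/16\<close> on a length of \<open>16/15 * r\<close> and \<open>3/4\<close> on a
  length of \<open>4/5 * r\<close> produce this drop and compensate it.\<close>

lemma hidden_shift:
  assumes "hidden f F c r"
  shows "\<exists>g G. hidden g G (c + 2 * r / 15) (r / 15) \<and> (\<forall>x. r \<le> \<bar>x - c\<bar> \<longrightarrow> G x = F x)"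
proof -
  let ?s = "\<lambda>p x::real. of_bool (x \<le> p) :: real"
  define g where "g = (\<lambda>x. f x - 9/16 * (?s (c + r/15) x - ?s (c - r) x)
      + 3/4 * (?s (c + r) x - ?s (c + r/5) x))"
  define G where "G = (\<lambda>x. F x - 9/16 * (min x (c + r/15) - min x (c - r))
      + 3/4 * (min x (c + r) - min x (c + r/5)))"
  note r = hiddenD(1-3)[OF assms] and cdf = hiddenD(4)[OF assms]
  note prof = hiddenD(5)[OF assms, unfolded profile_def]
  have f: "f x = 3/2" if "c - r < x" "x \<le> c + r" for x
    using hiddenD(6)[OF assms that] .
  have g_eq: "g x = (if c - r < x \<and> x \<le> c + r/15 then 15/16
      else if c + r/5 < x \<and> x \<le> c + r then 9/4 else f x)" for x
    unfolding g_def using r f[of x] by auto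
  have G_eq: "G x = F x" if "r \<le> \<bar>x - c\<bar>" for x
    unfolding G_def using that r by (cases "x \<le> c") (simp_all add: min_def)
  have "(g has_integral G x) {0..x}" if "x \<in> {0..1}" for x
    unfolding g_def G_def using that r has_cdf_integral[OF cdf, of x]
    by (intro has_integral_add has_integral_diff has_integral_mult_right has_integral_step) simp_all
  moreover have "9/16 \<le> g x" if "x \<in> {0..1}" for x
    unfolding g_eq using has_cdf_lower[OF cdf, of x] that by simp
  moreover have "G 1 = 1" using G_eq[of 1] has_cdf_at_1[OF cdf] r by simp
  ultimately have "has_cdf g G" unfolding has_cdf_def by blast
  moreover have "profile g G x" for x
  proof -
    have "G x = F x" if "x \<le> 29/48 \<or> 31/48 \<le> x"
      using that r by (intro G_eq) linarith
    moreover have "g x = f x" if "x \<le> 29/48 \<or> 31/48 < x"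
      unfolding g_eq using that r by auto
    moreover have "15/16 \<le> g x \<and> g x \<le> 9/4" if "29/48 < x" "x \<le> 31/48"
      unfolding g_eq using that prof[of x] by auto
    ultimately show ?thesis using prof[of x] unfolding profile_def by simp
  qed
  \<comment> \<open>The new window is the stretch between the two modifications, where the slope is
    untouched and only the drop by \<open>3/5 * r\<close> shows.\<close>
  moreover have "g x = 3/2" if "c + 2*r/15 - r/15 < x" "x \<le> c + 2*r/15 + r/15" for x
    unfolding g_eq using that f[of x] r by simp
  moreover have "G x = 21/8 - 3 * (c + 2*r/15) + 3/2 * (x - (c + 2*r/15))"
    if "\<bar>x - (c + 2*r/15)\<bar> \<le> r/15" for x
  proof -
    have x: "c + r/15 \<le> x" "x \<le> c + r/5" using that unfolding abs_le_iff by linarith+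
    then have "F x = 21/8 - 3 * c + 3/2 * (x - c)"
      using hiddenD(7)[OF assms, of x] r by (simp add: abs_le_iff)
    moreover have "min x (c + r/15) = c + r/15" "min x (c - r) = c - r"
      "min x (c + r) = x" "min x (c + r/5) = x"
      using x r by (simp_all add: min_def)
    ultimately show ?thesis unfolding G_def by argo
  qed
  ultimately have "hidden g G (c + 2 * r / 15) (r / 15)"
    unfolding hidden_def using r by (intro conjI allI impI) simp_all
  with G_eq show ?thesis by blast
qed

lemma window_mirror: "1 - x \<in> window c r \<longleftrightarrow> x \<in> window c r"
  unfolding window_def by (auto simp: abs_if split: if_splits)

section \<open>Rigidity of approximately envy-free divisions\<close>

lemma hidden_lipschitz:
  assumes "hidden f F c r" "0 \<le> x" "x \<le> y" "y \<le> 1"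
  shows "F y - F x \<le> 9/4 * (y - x)"
proof (rule has_integral_le)
  show "(f has_integral F y - F x) {x..y}"
    by (rule has_cdf_has_integral[OF hiddenD(4)[OF assms(1)] assms(2-)])
  show "((\<lambda>_. 9/4) has_integral 9/4 * (y - x)) {x..y}"
    using has_integral_const_real[of "9/4::real" x y] assms by (simp add: mult.commute)
  show "f z \<le> 9/4" for z
  proof -
    note pr = hiddenD(5)[OF assms(1), of z, unfolded profile_def]
    consider "z \<le> 1/3" | "1/3 < z" "z \<le> 29/48" | "29/48 < z" "z \<le> 31/48"
      | "31/48 < z" "z \<le> 2/3" | "2/3 < z" by linarith
    then show ?thesis by cases (use pr in simp_all)
  qed
qed

text \<open>The extreme case lies beyond 2/3, with 15/16 against 9/16. That 5/3 is below 2 is what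
  makes \<open>cyclic_order_rigid\<close> work.\<close>

lemma hidden_mirror_ratio:
  assumes h: "hidden f F c r" and xy: "0 \<le> x" "x \<le> y" "y \<le> 1"
  shows "F (1 - x) - F (1 - y) \<le> 5/3 * (F y - F x)"
proof (rule has_integral_le)
  note cdf = hiddenD(4)[OF h]
  show "((\<lambda>z. f (1 - z)) has_integral F (1 - x) - F (1 - y)) {x..y}"
    using has_cdf_has_integral[OF has_cdf_mirror[OF cdf] xy] by simp
  show "((\<lambda>z. 5/3 * f z) has_integral 5/3 * (F y - F x)) {x..y}"
    by (intro has_integral_mult_right has_cdf_has_integral[OF cdf xy])
  show "f (1 - z) \<le> 5/3 * f z" for z
  proof -
    note pr = hiddenD(5)[OF h, of z, unfolded profile_def]
      and mirror = hiddenD(5)[OF h, of "1 - z", unfolded profile_def]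
    consider "z < 1/3" | "z = 1/3" | "1/3 < z" "z < 17/48" | "17/48 \<le> z" "z < 19/48"
      | "19/48 \<le> z" "z \<le> 29/48" | "29/48 < z" "z \<le> 31/48" | "31/48 < z" "z < 2/3"
      | "z = 2/3" | "2/3 < z" by linarith
    then show ?thesis by cases (use pr mirror in simp_all)
  qed
qed

lemma hidden_mono:
  assumes "hidden f F c r" "0 \<le> x" "x \<le> y" "y \<le> 1"
  shows "F x \<le> F y"
  using has_cdf_increment[OF hiddenD(4)[OF assms(1)] assms(2-)] assms(3) by argo

lemma hidden_shifted_mono:
  assumes h: "hidden f F c r" and "0 \<le> x" "x \<le> 1" "0 \<le> y" "y \<le> 1" "0 < \<epsilon>" "x \<le> y + \<epsilon>"
  shows "F x \<le> F y + 9/4 * \<epsilon>"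
proof (cases "x \<le> y")
  case True
  then show ?thesis using hidden_mono[OF h, of x y] assms by simp
next
  case False
  then show ?thesis using hidden_lipschitz[OF h, of y x] assms by simp
qed

text \<open>The zero of the increasing function \<open>2 F p - F (1 - p)\<close> is \<open>1 - c\<close>.\<close>

lemma hidden_gap:
  assumes h: "hidden f F c r" and p: "0 \<le> p" "p \<le> 1" "p \<notin> window c r"
  shows "9/2 * r \<le> \<bar>2 * F p - F (1 - p)\<bar>"
proof -
  note r = hiddenD(1-3)[OF h]
  note pr = hiddenD(5)[OF h, unfolded profile_def] and w = hiddenD(7)[OF h]
  \<comment> \<open>Moving \<open>p\<close> from \<open>1 - c\<close> by \<open>r\<close> changes
    \<open>2 * F p\<close> by \<open>3 * r\<close> and \<open>F (1 - p)\<close> by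
    \<open>3/2 * r\<close> in the opposite direction; monotonicity covers points farther
    away.\<close>
  consider "p \<le> 1 - c - r" | "1 - c + r \<le> p"
    using p(3) unfolding window_def by fastforce
  then show ?thesis
  proof cases
    case 1
    have "F p \<le> F (1 - c - r)" "F (c + r) \<le> F (1 - p)"
      using 1 p r by (auto intro!: hidden_mono[OF h])
    moreover have "F (1 - c - r) = 3/2 * (1 - c - r) - 3/16" using pr[of "1 - c - r"] r by simp
    moreover have "F (c + r) = 21/8 - 3 * c + 3/2 * r" using w[of "c + r"] r by simp
    ultimately show ?thesis by argo
  next
    case 2
    have "F (1 - c + r) \<le> F p" "F (1 - p) \<le> F (c - r)"
      using 2 p r by (auto intro!: hidden_mono[OF h])
    moreover have "F (1 - c + r) = 3/2 * (1 - c + r) - 3/16" using pr[of "1 - c + r"] r by simp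
    moreover have "F (c - r) = 21/8 - 3 * c - 3/2 * r" using w[of "c - r"] r by simp
    ultimately show ?thesis by argo
  qed
qed

text \<open>The cuts are \<open>x\<close> and \<open>1 - z\<close>, so that mirroring the cake exchanges \<open>x\<close> and \<open>z\<close>.\<close>

lemma cyclic_order_rigid:
  assumes h: "hidden f F c r" and x: "0 \<le> x" "x \<le> 1" and z: "0 \<le> z" "z \<le> 1" and e: "0 < \<epsilon>"
    and "F (1 - z) \<le> 2 * F x + \<epsilon>" "2 * F z \<le> F (1 - x) + \<epsilon>" "x \<le> z + \<epsilon>"
  shows "\<bar>2 * F x - F (1 - x)\<bar> \<le> 11 * \<epsilon>"
proof -
  have "F x \<le> F z + 9/4 * \<epsilon>" by (rule hidden_shifted_mono[OF h]) (use assms in auto)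
  moreover have "F (1 - x) \<le> 2 * F x + 11 * \<epsilon>"
  proof (cases "x \<le> z")
    case True
    \<comment> \<open>Inserting the bounds on \<open>F (1 - z)\<close> and \<open>F z\<close> yields
      \<open>F (1 - x) \<le> F x / 3 + 5/6 * F (1 - x) + 11/6 * \<epsilon>\<close>; solving for
      \<open>F (1 - x)\<close> gives the constant 11.\<close>
    have "F (1 - x) - F (1 - z) \<le> 5/3 * (F z - F x)"
      by (rule hidden_mirror_ratio[OF h]) (use x z True in auto)
    then show ?thesis using assms by argo
  next
    case False
    then have "F (1 - x) \<le> F (1 - z)" by (intro hidden_mono[OF h]) (use x z in auto)
    then show ?thesis using assms by argo
  qed
  ultimately show ?thesis using assms by (simp add: abs_le_iff)
qed

section \<open>Orders of the pieces that near envy-freeness rules out\<close>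

text \<open>The uniform player holds the middle piece, between ends of lengths \<open>x\<close> and
  \<open>z\<close>. Its lack of envy towards the longer end gives
  \<open>z \<le> (1 + \<epsilon>) / 2\<close> and
  \<open>x \<le> (1 + \<epsilon>) / 3\<close>.\<close>

lemma largest_middle_bounds:
  assumes h: "hidden f F c r" and e: "0 < \<epsilon>" "\<epsilon> \<le> 1/10000"
    and x: "0 \<le> x" and z: "0 \<le> z" "x \<le> z" "z \<le> 1 - x - z + \<epsilon>"
  shows "561/1000 \<le> F (1 - z)" "F x \<le> 5/16 + 3/2 * \<epsilon>" "F x \<le> 15/16 * x + 9/4 * \<epsilon>"
proof -
  note pr = hiddenD(5)[OF h, unfolded profile_def]
  have "F (499/1000) \<le> F (1 - z)" using x z e by (intro hidden_mono[OF h]) auto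
  moreover have "F (499/1000) = 3/2 * (499/1000) - 3/16" using pr[of "499/1000"] by simp
  ultimately show "561/1000 \<le> F (1 - z)" by argo
  have x2: "x \<le> 1/3 + \<epsilon>" using z e by argo
  then have "F x \<le> F (1/3 + \<epsilon>)" using x e by (intro hidden_mono[OF h]) auto
  moreover have "F (1/3 + \<epsilon>) = 3/2 * (1/3 + \<epsilon>) - 3/16" using pr[of "1/3 + \<epsilon>"] e by simp
  ultimately show "F x \<le> 5/16 + 3/2 * \<epsilon>" by argo
  show "F x \<le> 15/16 * x + 9/4 * \<epsilon>"
  proof (cases "x \<le> 1/3")
    case True then show ?thesis using pr[of x] x e by auto
  next
    case False then show ?thesis using pr[of x] x2 e by auto
  qed
qed

text \<open>Player 1 has the left end, player 2 the right one. Mirroring exchanges \<open>x\<close>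
  and \<open>z\<close>, so let \<open>x \<le> z\<close>. If player 1 does not envy the middle,
  \<open>x\<close> is not far below 1/3 and \<open>z\<close> not far above it; but then player 1
  values the middle at about 15/32 or more and the left end at about 5/16 or less.\<close>

lemma not_left_right_middle:
  assumes h: "hidden f F c r" and x: "0 \<le> x" and z: "0 \<le> z" "x + z \<le> 1"
    and e: "0 < \<epsilon>" "\<epsilon> \<le> 1/10000"
    and 1: "F (1 - z) \<le> 2 * F x + \<epsilon>" and 2: "F (1 - x) \<le> 2 * F z + \<epsilon>"
    and 3: "x \<le> 1 - x - z + \<epsilon>" "z \<le> 1 - x - z + \<epsilon>"
  shows False
proof -
  have *: False if x: "0 \<le> x" and z: "0 \<le> z" "x \<le> z" and 1: "F (1 - z) \<le> 2 * F x + \<epsilon>"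
    and 3: "z \<le> 1 - x - z + \<epsilon>" for x z
  proof -
    note bounds = largest_middle_bounds[OF h e x z 3]
    have "298/1000 \<le> x" using bounds(1,3) 1 e by argo
    with z 3 e have "31/48 \<le> 1 - z" by argo
    then have "F (31/48) \<le> F (1 - z)" using z by (intro hidden_mono[OF h]) auto
    moreover have "F (31/48) = 25/32"
      using hiddenD(5)[OF h, of "31/48", unfolded profile_def] by simp
    ultimately show False using bounds(2) 1 e by argo
  qed
  show False
  proof (cases "x \<le> z")
    case True then show ?thesis using *[of x z] assms by auto
  next
    case False then show ?thesis using *[of z x] assms by auto
  qed
qed

text \<open>Now player 2 has the left end and player 1 the right one, which is the longer if
  \<open>x \<le> z\<close>. Lack of envy towards the middle bounds \<open>x\<close> from below,
  which pushes \<open>1 - z\<close> up to 564/1000, where \<open>2 * F (1 - z)\<close> is about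
  1.317 while \<open>1 + F x\<close> is at most about 1.3125.\<close>

lemma not_right_left_middle:
  assumes h: "hidden f F c r" and x: "0 \<le> x" and z: "0 \<le> z" "x + z \<le> 1"
    and e: "0 < \<epsilon>" "\<epsilon> \<le> 1/10000"
    and 1: "2 * F (1 - z) \<le> 1 + F x + \<epsilon>" and 2: "2 * F (1 - x) \<le> 1 + F z + \<epsilon>"
    and 3: "x \<le> 1 - x - z + \<epsilon>" "z \<le> 1 - x - z + \<epsilon>"
  shows False
proof -
  have *: False if x: "0 \<le> x" and z: "0 \<le> z" "x \<le> z" and 1: "2 * F (1 - z) \<le> 1 + F x + \<epsilon>"
    and 3: "z \<le> 1 - x - z + \<epsilon>" for x z
  proof -
    note bounds = largest_middle_bounds[OF h e x z 3]
    have "129/1000 \<le> x" using bounds(1,3) 1 e by argo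
    with z 3 e have "564/1000 \<le> 1 - z" by argo
    then have "F (564/1000) \<le> F (1 - z)" using z by (intro hidden_mono[OF h]) auto
    moreover have "F (564/1000) = 3/2 * (564/1000) - 3/16"
      using hiddenD(5)[OF h, of "564/1000", unfolded profile_def] by simp
    ultimately show False using bounds(2) 1 e by argo
  qed
  show False
  proof (cases "x \<le> z")
    case True then show ?thesis using *[of x z] assms by auto
  next
    case False then show ?thesis using *[of z x] assms by auto
  qed
qed

text \<open>Player 3 holds \<open>[0,p]\<close> and player 1 \<open>[q,1]\<close>. Player 3 forces
  \<open>p\<close> and \<open>1 - q\<close> to satisfy \<open>p \<ge> 1/3 - \<epsilon>\<close> and
  \<open>1 - q \<le> p + \<epsilon>\<close>, while player 1 must not prefer the left end. Up to
  \<open>p = 29/48\<close> this fails since \<open>F p + F (1 - p)\<close> is at least about 33/32;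
  beyond, already \<open>2 * F p\<close> is too large.\<close>

lemma not_right_middle_left:
  assumes h: "hidden f F c r" and pq: "0 \<le> p" "p \<le> q" "q \<le> 1"
    and e: "0 < \<epsilon>" "\<epsilon> \<le> 1/10000"
    and 1: "F p + F q \<le> 1 + \<epsilon>" and 3: "q - p \<le> p + \<epsilon>" "1 - q \<le> p + \<epsilon>"
  shows False
proof -
  note pr = hiddenD(5)[OF h, unfolded profile_def]
  have p1: "1/3 - \<epsilon> \<le> p" using 3 e pq by argo
  have "F (1/3) \<le> F p + 9/4 * \<epsilon>"
    using p1 e pq by (intro hidden_shifted_mono[OF h]) auto
  then have Fp: "5/16 - 9/4 * \<epsilon> \<le> F p" using pr[of "1/3"] by simp
  have Fq: "F (1 - p) \<le> F q + 9/4 * \<epsilon>"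
    using 3 e pq by (intro hidden_shifted_mono[OF h]) auto
  consider "p \<le> 19/48" | "19/48 \<le> p" "p \<le> 29/48" | "29/48 \<le> p" by linarith
  then show False
  proof cases
    case 1
    then have "F (29/48) \<le> F (1 - p)" using pq by (intro hidden_mono[OF h]) auto
    moreover have "F (29/48) = 23/32" using pr[of "29/48"] by simp
    ultimately show False using Fp Fq assms by argo
  next
    case 2
    then have "F p = 3/2 * p - 3/16" "F (1 - p) = 3/2 * (1 - p) - 3/16"
      using pr[of p] pr[of "1 - p"] by auto
    then show False using Fq assms by argo
  next
    case 3
    then have "F (29/48) \<le> F p" "F p \<le> F q" using pq by (auto intro!: hidden_mono[OF h])
    moreover have "F (29/48) = 23/32" using pr[of "29/48"] by simp
    ultimately show False using assms by argo
  qed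
qed

section \<open>Connected allocations to three players\<close>

lemma interval_ends:
  fixes S :: "real set"
  assumes "is_interval S" "S \<subseteq> {0..1}" "S \<noteq> {}"
  shows "{Inf S<..<Sup S} \<subseteq> S" "S \<subseteq> {Inf S..Sup S}" "Inf S \<in> frontier S" "Sup S \<in> frontier S"
    and "0 \<le> Inf S" "Inf S \<le> Sup S" "Sup S \<le> 1"
proof -
  have bdd: "bdd_below S" "bdd_above S"
    using assms(2) by (auto intro: bdd_below_mono bdd_above_mono)
  show "{Inf S<..<Sup S} \<subseteq> S"
  proof
    fix x assume "x \<in> {Inf S<..<Sup S}"
    then obtain y z where "y \<in> S" "y < x" "z \<in> S" "x < z"
      using cInf_lessD[OF assms(3), of x] less_cSupD[OF assms(3), of x] by auto
    with assms(1) show "x \<in> S" by (meson is_interval_1 less_imp_le)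
  qed
  show sub: "S \<subseteq> {Inf S..Sup S}" using bdd by (auto intro: cInf_lower cSup_upper)
  have "interior S \<subseteq> {Inf S<..<Sup S}"
    using interior_mono[OF sub] by simp
  moreover have "Inf S \<in> closure S" "Sup S \<in> closure S"
    using bdd assms(3) by (auto intro: closure_contains_Inf closure_contains_Sup)
  ultimately show "Inf S \<in> frontier S" "Sup S \<in> frontier S" by (auto simp: frontier_def)
  show "0 \<le> Inf S" by (rule cInf_greatest[OF assms(3)]) (use assms(2) in auto)
  show "Sup S \<le> 1" by (rule cSup_least[OF assms(3)]) (use assms(2) in auto)
  show "Inf S \<le> Sup S" using sub assms(3) by force
qed

lemma non_overlapping_intervals:
  fixes S T :: "real set"
  assumes "negligible (S \<inter> T)" "{a<..<b} \<subseteq> S" "{p<..<q} \<subseteq> T" "a < b" "p < q"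
  shows "b \<le> p \<or> q \<le> a"
proof (rule ccontr)
  assume "\<not> ?thesis"
  then have "max a p < min b q" using assms(4,5) by simp
  moreover have "{max a p<..<min b q} \<subseteq> S \<inter> T" using assms(2,3) by auto
  then have "negligible {max a p<..<min b q}" using assms(1) by (rule negligible_subset[rotated])
  then have "{max a p<..<min b q} = {}"
    using negligible_interval(2)[of "max a p" "min b q"] by (simp only: box_real)
  ultimately show False
    using dense[of "max a p" "min b q"] by (auto simp del: max_less_iff_conj min_less_iff_conj)
qed

lemma covering_in_order:
  fixes l u :: "3 \<Rightarrow> real"
  assumes cover: "\<And>x. 0 \<le> x \<Longrightarrow> x \<le> 1 \<Longrightarrow> \<exists>j. l j \<le> x \<and> x \<le> u j"
    and lu: "\<And>j. 0 \<le> l j" "\<And>j. l j < u j" "\<And>j. u j \<le> 1"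
    and abc: "UNIV = {a, b, c}" "u a \<le> l b" "u b \<le> l c"
  shows "l a = 0" "u a = l b" "u b = l c" "u c = 1"
proof -
  have cover': "(l a \<le> x \<and> x \<le> u a) \<or> (l b \<le> x \<and> x \<le> u b) \<or> (l c \<le> x \<and> x \<le> u c)"
    if "0 \<le> x" "x \<le> 1" for x
  proof -
    obtain j where j: "l j \<le> x" "x \<le> u j" using cover[OF \<open>0 \<le> x\<close> \<open>x \<le> 1\<close>] by blast
    have "j \<in> {a, b, c}" using abc(1) by blast
    then show ?thesis using j by auto
  qed
  note facts = lu(1)[of a] lu(2)[of a] lu(2)[of b] lu(2)[of c] lu(3)[of c] abc(2,3)
  show "l a = 0" using cover'[of 0] facts by argo
  show "u c = 1" using cover'[of 1] facts by argo
  \<comment> \<open>The midpoint of a gap between neighbouring pieces would be uncovered.\<close>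
  show "u a = l b" using cover'[of "(u a + l b) / 2"] facts by argo
  show "u b = l c" using cover'[of "(u b + l c) / 2"] facts by argo
qed

text \<open>Of the six orders of the players from left to right, 1-2-3 and 3-1-2 force a cut into
  the window; the other four are impossible.\<close>

lemma hidden_not_envy_free:
  assumes h: "hidden f F c r" and e: "0 < \<epsilon>" "\<epsilon> \<le> 1/10000" "3 * \<epsilon> \<le> r"
    and A: "connected_allocation A" and ef: "envy_free_upto \<epsilon> (players f) A"
  shows "\<exists>i. \<exists>x\<in>frontier (A i). x \<in> window c r"
proof (rule ccontr)
  assume neg: "\<not> ?thesis"
  define l u where "l i = Inf (A i)" and "u i = Sup (A i)" for i
  have int: "is_interval (A i)" "A i \<subseteq> {0..1}" for i
    using A by (auto simp: connected_allocation_def allocation_def piece_def)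
  have cover: "\<exists>j. x \<in> A j" if "x \<in> {0..1}" for x
    using A that unfolding connected_allocation_def allocation_def by blast
  have negl: "negligible (A i \<inter> A j)" if "i \<noteq> j" for i j
    using A that unfolding connected_allocation_def allocation_def by blast
  have cdf: "has_cdf (players f i) (players_cdf F i)" for i by (rule has_cdf_players[OF h])
  have val: "val (players f i) (A j) = players_cdf F i (u j) - players_cdf F i (l j)"
    if "A j \<noteq> {}" for i j
    unfolding l_def u_def using interval_ends[OF int that] by (intro val_between[OF cdf])
  have envy: "val (players f i) (A j) - \<epsilon> \<le> val (players f i) (A i)" for i j
    using ef unfolding envy_free_upto_def by simp

  \<comment> \<open>Pigeonhole on 0, 1/3, 2/3, 1: some piece spans at least 1/3 and is worth at
    least 3/16 to everybody, so nobody's own piece can be worthless.\<close>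
  have "\<exists>j. \<exists>x\<in>A j. \<exists>y\<in>A j. x + 1/3 \<le> y"
  proof -
    obtain p where p: "\<And>k. k \<le> 3 \<Longrightarrow> real k / 3 \<in> A (p k)"
    proof -
      have "\<exists>j. real k / 3 \<in> A j" if "k \<le> 3" for k using that by (intro cover) auto
      then show ?thesis using that by metis
    qed
    have "\<not> inj_on p {..3::nat}"
    proof (rule pigeonhole)
      have "card (p ` {..3}) \<le> card (UNIV :: 3 set)" by (rule card_mono) auto
      then show "card (p ` {..3}) < card {..3::nat}" by simp
    qed
    then obtain k m where "k \<le> 3" "m \<le> 3" "p k = p m" "k < m"
      unfolding inj_on_def by (metis atMost_iff nat_neq_iff)
    moreover from this have "real k / 3 + 1/3 \<le> real m / 3" by simp
    ultimately show ?thesis using p[of k] p[of m] by metis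
  qed
  then obtain j x y where xy: "x \<in> A j" "y \<in> A j" "x + 1/3 \<le> y" by blast
  have large: "3/16 \<le> val (players f i) (A j)" for i
  proof -
    have ne: "A j \<noteq> {}" using xy by auto
    then have "l j \<le> x" "y \<le> u j" using xy interval_ends(2)[OF int ne] by (auto simp: l_def u_def)
    moreover have "9/16 * (u j - l j) \<le> players_cdf F i (u j) - players_cdf F i (l j)"
      using interval_ends[OF int ne] unfolding l_def u_def by (intro has_cdf_increment[OF cdf]) auto
    ultimately show ?thesis unfolding val[OF ne] using xy(3) by argo
  qed
  have pos: "0 < val (players f i) (A i)" for i
    using envy[of i j] large[of i] e by argo
  have ne: "A i \<noteq> {}" for i
    using pos[of i] by (auto simp: val_def set_lebesgue_integral_def)
  note ends = interval_ends[OF int ne, folded l_def u_def]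
  have lu: "l i < u i" for i
    using pos[of i] val[OF ne, of i i] ends(6)[of i] by (cases "l i = u i") (auto simp: l_def u_def)
  have outside: "l i \<notin> window c r" "u i \<notin> window c r" for i
    using neg ends(3,4)[of i] by (auto simp: l_def u_def)
  have order: "u i \<le> l j \<or> u j \<le> l i" if "i \<noteq> j" for i j
    using non_overlapping_intervals[OF negl[OF that] _ _ lu lu] ends(1)
    by (simp add: l_def u_def)
  have divide: "\<exists>x y. 0 \<le> x \<and> x \<le> y \<and> y \<le> 1 \<and> x \<notin> window c r \<and> y \<notin> window c r \<and>
      l a = 0 \<and> u a = x \<and> l b = x \<and> u b = y \<and> l d = y \<and> u d = 1"
    if "UNIV = {a, b, d}" "u a \<le> l b" "u b \<le> l d" for a b d
  proof -
    have "\<exists>j. l j \<le> x \<and> x \<le> u j" if x: "0 \<le> x" "x \<le> 1" for x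
    proof -
      obtain j where "x \<in> A j" using cover[of x] x by auto
      then have "x \<in> {l j..u j}" using ends(2)[of j] by blast
      then show ?thesis by auto
    qed
    from covering_in_order[OF this _ lu _ that]
    have "l a = 0" "u a = l b" "u b = l d" "u d = 1"
      using ends(5,7) by (auto simp: l_def u_def)
    then show ?thesis using lu[of a] lu[of b] lu[of d] outside[of a] outside[of b]
      by (intro exI[of _ "u a"] exI[of _ "u b"]) auto
  qed
  have E: "players_cdf F i (u j) - players_cdf F i (l j) - \<epsilon>
      \<le> players_cdf F i (u i) - players_cdf F i (l i)" for i j using envy[of i j] unfolding val[OF ne] .
  have F01: "F 0 = 0" "F 1 = 1"
    using hiddenD(4)[OF h] by (auto intro: has_cdf_at_0 has_cdf_at_1)
  have E1: "F (u j) - F (l j) - \<epsilon> \<le> F (u 1) - F (l 1)"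
    and E2: "F (1 - l j) - F (1 - u j) - \<epsilon> \<le> F (1 - l 2) - F (1 - u 2)"
    and E3: "u j - l j - \<epsilon> \<le> u 3 - l 3" for j
    using E[of 1 j] E[of 2 j] E[of 3 j] by (simp_all add: players_cdf_def)
  note E = E1[of 2] E1[of 3] E2[of 1] E2[of 3] E3[of 1] E3[of 2]
  have UNIV3: "UNIV = {1, 2, 3::3}" "UNIV = {1, 3, 2::3}" "UNIV = {2, 1, 3::3}" "UNIV = {2, 3, 1::3}"
    "UNIV = {3, 1, 2::3}" "UNIV = {3, 2, 1::3}"
    using UNIV_3 by auto
  \<comment> \<open>By \<open>hidden_gap\<close> and \<open>3 * \<epsilon> \<le> r\<close> the
    absolute value is at least \<open>27/2 * \<epsilon>\<close>, more than
    \<open>11 * \<epsilon>\<close>.\<close>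
  have rigid: False if "p \<in> {0..1}" "p \<notin> window c r" "\<bar>2 * F p - F (1 - p)\<bar> \<le> 11 * \<epsilon>" for p
    using hidden_gap[OF h, of p] that e by auto
  have "(u 1 \<le> l 2 \<and> u 2 \<le> l 3) \<or> (u 1 \<le> l 3 \<and> u 3 \<le> l 2) \<or> (u 2 \<le> l 1 \<and> u 1 \<le> l 3) \<or>
    (u 2 \<le> l 3 \<and> u 3 \<le> l 1) \<or> (u 3 \<le> l 1 \<and> u 1 \<le> l 2) \<or> (u 3 \<le> l 2 \<and> u 2 \<le> l 1)"
    using order[of 1 2] order[of 1 3] order[of 2 3] lu[of 1] lu[of 2] lu[of 3] by (simp, argo)
  then show False
  proof (elim disjE conjE)
    assume "u 1 \<le> l 2" "u 2 \<le> l 3"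
    from divide[OF UNIV3(1) this] obtain x y where xy: "0 \<le> x" "x \<le> y" "y \<le> 1"
      "x \<notin> window c r" "y \<notin> window c r" "l 1 = 0" "u 1 = x" "l 2 = x" "u 2 = y" "l 3 = y" "u 3 = 1" by blast
    \<comment> \<open>The comparisons that enter are player 1 with 2, 2 with 3 and 3 with 1; for the
      order 3-1-2 the cycle is reversed.\<close>
    have "\<bar>2 * F x - F (1 - x)\<bar> \<le> 11 * \<epsilon>"
      by (rule cyclic_order_rigid[OF h, of x "1 - y"]) (use E xy F01 e in simp_all)
    then show False using rigid[of x] xy by simp
  next
    assume "u 1 \<le> l 3" "u 3 \<le> l 2"
    from divide[OF UNIV3(2) this] obtain x y where xy: "0 \<le> x" "x \<le> y" "y \<le> 1"
      "l 1 = 0" "u 1 = x" "l 3 = x" "u 3 = y" "l 2 = y" "u 2 = 1" by blast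
    show False
      by (rule not_left_right_middle[OF h, of x "1 - y" \<epsilon>]) (use E xy F01 e in simp_all)
  next
    assume "u 2 \<le> l 1" "u 1 \<le> l 3"
    from divide[OF UNIV3(3) this] obtain x y where xy: "0 \<le> x" "x \<le> y" "y \<le> 1"
      "l 2 = 0" "u 2 = x" "l 1 = x" "u 1 = y" "l 3 = y" "u 3 = 1" by blast
    show False
      by (rule not_right_middle_left[OF h, of "1 - y" "1 - x" \<epsilon>]) (use E xy F01 e in simp_all)
  next
    assume "u 2 \<le> l 3" "u 3 \<le> l 1"
    from divide[OF UNIV3(4) this] obtain x y where xy: "0 \<le> x" "x \<le> y" "y \<le> 1"
      "l 2 = 0" "u 2 = x" "l 3 = x" "u 3 = y" "l 1 = y" "u 1 = 1" by blast
    show False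
      by (rule not_right_left_middle[OF h, of x "1 - y" \<epsilon>]) (use E xy F01 e in simp_all)
  next
    assume "u 3 \<le> l 1" "u 1 \<le> l 2"
    from divide[OF UNIV3(5) this] obtain x y where xy: "0 \<le> x" "x \<le> y" "y \<le> 1"
      "x \<notin> window c r" "y \<notin> window c r" "l 3 = 0" "u 3 = x" "l 1 = x" "u 1 = y" "l 2 = y" "u 2 = 1" by blast
    have "\<bar>2 * F (1 - y) - F (1 - (1 - y))\<bar> \<le> 11 * \<epsilon>"
      by (rule cyclic_order_rigid[OF h, of "1 - y" x]) (use E xy F01 e in simp_all)
    then show False using rigid[of "1 - y"] window_mirror[of y] xy by simp
  next
    assume "u 3 \<le> l 2" "u 2 \<le> l 1"
    from divide[OF UNIV3(6) this] obtain x y where xy: "0 \<le> x" "x \<le> y" "y \<le> 1"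
      "l 3 = 0" "u 3 = x" "l 2 = x" "u 2 = y" "l 1 = y" "u 1 = 1" by blast
    show False
      by (rule not_right_middle_left[OF h, of x y \<epsilon>]) (use E xy F01 e in simp_all)
  qed
qed

section \<open>The adversary\<close>

text \<open>In both cases \<open>y\<close> is the abscissa of the revealed graph point: the answer
  to Cut, the argument of Eval.\<close>

fun avoids :: "real set \<Rightarrow> 'p query \<times> real \<Rightarrow> bool" where
  "avoids W (Cut i \<alpha>, y) \<longleftrightarrow> \<alpha> \<in> {0..1} \<and> y \<in> {0..1} - W"
| "avoids W (Eval i y, a) \<longleftrightarrow> y \<in> {0..1} - W"

lemma val_initial:
  assumes "hidden f F c r" "y \<in> {0..1}"
  shows "val (players f i) {0..y} = players_cdf F i y"
proof -
  note cdf = has_cdf_players[OF assms(1), of i]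
  have "val (players f i) {0..y} = players_cdf F i y - players_cdf F i 0"
    using assms(2) by (intro val_between[OF cdf]) auto
  then show ?thesis using has_cdf_at_0[OF cdf] by simp
qed

lemma cut_answer:
  assumes "valid_cut_rule \<tau>" "hidden f F c r" "\<alpha> \<in> {0..1}"
  shows "\<tau> i (players f i) \<alpha> \<in> {0..1}" "players_cdf F i (\<tau> i (players f i) \<alpha>) = \<alpha>"
proof -
  have *: "\<tau> i (players f i) \<alpha> \<in> {0..1} \<and> val (players f i) {0..\<tau> i (players f i) \<alpha>} = \<alpha>"
    using assms(1,3) has_cdf_value_density[OF has_cdf_players[OF assms(2)]]
    unfolding valid_cut_rule_def by blast
  then show "\<tau> i (players f i) \<alpha> \<in> {0..1}" by blast
  from val_initial[OF assms(2) this] *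
  show "players_cdf F i (\<tau> i (players f i) \<alpha>) = \<alpha>" by simp
qed

lemma players_cdf_cong:
  assumes "\<And>x. r \<le> \<bar>x - c\<bar> \<Longrightarrow> G x = F x" "y \<notin> window c r"
  shows "players_cdf G i y = players_cdf F i y"
proof -
  have "G y = F y" "G (1 - y) = F (1 - y)"
    using assms(2) by (auto intro!: assms(1) simp: window_def)
  then show ?thesis by (simp add: players_cdf_def)
qed

text \<open>An old cut point outside the window keeps its value under the new densities, and strict
  monotonicity leaves no other point of that value, so the cut rule must return it again.\<close>

lemma answer_cong:
  assumes \<tau>: "valid_cut_rule \<tau>" and h: "hidden f F c r" "hidden g G c' r'"
    and eq: "\<And>x. r \<le> \<bar>x - c\<bar> \<Longrightarrow> G x = F x"
    and av: "avoids (window c r) (q, answer \<tau> (players f) q)"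
  shows "answer \<tau> (players g) q = answer \<tau> (players f) q"
proof (cases q)
  case (Cut i \<alpha>)
  let ?y = "\<tau> i (players f i) \<alpha>" and ?z = "\<tau> i (players g i) \<alpha>"
  have \<alpha>: "\<alpha> \<in> {0..1}" and y: "?y \<notin> window c r" using av Cut by auto
  have "players_cdf G i ?z = players_cdf G i ?y"
    using cut_answer(2)[OF \<tau> h(1) \<alpha>] cut_answer(2)[OF \<tau> h(2) \<alpha>]
      players_cdf_cong[OF eq y] by simp
  then have "?z = ?y"
    by (rule has_cdf_inj[OF has_cdf_players[OF h(2)] cut_answer(1)[OF \<tau> h(2) \<alpha>]
          cut_answer(1)[OF \<tau> h(1) \<alpha>]])
  then show ?thesis using Cut by simp
next
  case (Eval i y)
  then show ?thesis using av val_initial[OF h(1)] val_initial[OF h(2)] players_cdf_cong[OF eq]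
    by auto
qed

section \<open>Two candidate windows inside the old one\<close>

lemma window_mono:
  assumes "\<bar>c' - c\<bar> + r' \<le> r"
  shows "window c' r' \<subseteq> window c r"
  using assms unfolding window_def by auto

lemma window_cases:
  assumes "x \<in> window c r" "29/48 \<le> c - r" "c + r \<le> 31/48"
  obtains "\<bar>x - c\<bar> < r" "29/48 < x" "x < 31/48" | "\<bar>x - (1 - c)\<bar> < r" "17/48 < x" "x < 19/48"
proof -
  from assms(1) consider "\<bar>x - c\<bar> < r" | "\<bar>x - (1 - c)\<bar> < r" unfolding window_def by blast
  then show thesis
  proof cases
    case 1
    then have "29/48 < x" "x < 31/48" using assms(2,3) by argo+
    with 1 that(1) show thesis by blast
  next
    case 2
    then have "17/48 < x" "x < 19/48" using assms(2,3) by argo+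
    with 2 that(2) show thesis by blast
  qed
qed

lemma windows_disjoint:
  assumes h: "hidden f F c s" "hidden g G (c + 2 * s) s"
  shows "window c s \<inter> window (c + 2 * s) s = {}"
proof (rule equals0I)
  fix x assume "x \<in> window c s \<inter> window (c + 2 * s) s"
  then have x: "x \<in> window c s" "x \<in> window (c + 2 * s) s" by auto
  show False
  proof (cases rule: window_cases[OF x(1) hiddenD(2,3)[OF h(1)]])
    case x1: 1
    show False
      by (cases rule: window_cases[OF x(2) hiddenD(2,3)[OF h(2)]]) (use x1 in argo)+
  next
    case x1: 2
    show False
      by (cases rule: window_cases[OF x(2) hiddenD(2,3)[OF h(2)]]) (use x1 in argo)+
  qed
qed

text \<open>A Cut query fixes a value, and the two candidates may answer it with different points,
  so the images must be disjoint too. Near the centres the lines differ by \<open>6 * s\<close> and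
  vary by less than \<open>3/2 * s\<close>; near the mirrored centres both functions follow one
  line; the mixed cases set values from 23/32 up against values below 13/32.\<close>

lemma windows_separated:
  assumes h: "hidden f F c s" "hidden g G (c + 2 * s) s"
    and x: "x \<in> window c s" and y: "y \<in> window (c + 2 * s) s" and eq: "F x = G y"
  shows False
proof -
  have val: "23/32 \<le> F z" if "29/48 < z" "z < 31/48" "hidden f F c r" for z f F c r
  proof -
    have "F (29/48) \<le> F z" using that by (intro hidden_mono[OF that(3)]) auto
    then show ?thesis using hiddenD(5)[OF that(3), of "29/48"] unfolding profile_def by simp
  qed
  have val': "F z = 3/2 * z - 3/16" if "17/48 < z" "z < 19/48" "hidden f F c r" for z f F c r
    using hiddenD(5)[OF that(3), of z] that(1,2) unfolding profile_def by simp
  show False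
  proof (cases rule: window_cases[OF x hiddenD(2,3)[OF h(1)]])
    case x: 1
    show False
    proof (cases rule: window_cases[OF y hiddenD(2,3)[OF h(2)]])
      case y: 1
      have "F x = 21/8 - 3 * c + 3/2 * (x - c)" using hiddenD(7)[OF h(1)] x by simp
      moreover have "G y = 21/8 - 3 * (c + 2 * s) + 3/2 * (y - (c + 2 * s))"
        using hiddenD(7)[OF h(2)] y by simp
      ultimately show False using x(1) y(1) eq by argo
    next
      case y: 2
      show False using val[OF x(2,3) h(1)] val'[OF y(2,3) h(2)] y(3) eq by argo
    qed
  next
    case x: 2
    show False
    proof (cases rule: window_cases[OF y hiddenD(2,3)[OF h(2)]])
      case y: 1
      show False using val[OF y(2,3) h(2)] val'[OF x(2,3) h(1)] x(3) eq by argo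
    next
      case y: 2
      show False using val'[OF x(2,3) h(1)] val'[OF y(2,3) h(2)] x(1) y(1) eq by argo
    qed
  qed
qed

lemma players_windows_separated:
  assumes h: "hidden f F c s" "hidden g G (c + 2 * s) s"
    and xy: "x \<in> window c s" "y \<in> window (c + 2 * s) s"
  shows "players_cdf F i x \<noteq> players_cdf G i y"
  using windows_separated[OF h xy] windows_separated[OF h, of "1 - x" "1 - y"]
    windows_disjoint[OF h] xy
  by (auto simp: players_cdf_def window_mirror)

definition query_ok :: "'p query \<Rightarrow> bool" where
  "query_ok q \<longleftrightarrow> (case q of Cut i \<alpha> \<Rightarrow> \<alpha> \<in> {0..1} | Eval i y \<Rightarrow> y \<in> {0..1})"

lemma adversary_step:
  assumes \<tau>: "valid_cut_rule \<tau>" and h: "hidden f F c r" and q: "query_ok q"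
  obtains g G c' where "hidden g G c' (r / 15)" "window c' (r / 15) \<subseteq> window c r"
    "\<And>x. r \<le> \<bar>x - c\<bar> \<Longrightarrow> G x = F x"
    "avoids (window c' (r / 15)) (q, answer \<tau> (players g) q)"
proof -
  let ?s = "r / 15"
  obtain g G where shift: "hidden g G (c + 2 * r / 15) ?s" "\<And>x. r \<le> \<bar>x - c\<bar> \<Longrightarrow> G x = F x"
    using hidden_shift[OF h] by blast
  then have g: "hidden g G (c + 2 * ?s) ?s" by simp
  note narrow = hidden_narrow[OF h]
  have sub: "window c ?s \<subseteq> window c r" "window (c + 2 * ?s) ?s \<subseteq> window c r"
    using hiddenD(1)[OF h] by (auto intro!: window_mono)
  \<comment> \<open>If both candidates failed, the two cut answers would lie in the two windows and
    share the value \<open>\<alpha>\<close>, or the Eval point would lie in both windows.\<close>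
  have "avoids (window c ?s) (q, answer \<tau> (players f) q) \<or>
    avoids (window (c + 2 * ?s) ?s) (q, answer \<tau> (players g) q)"
  proof (cases q)
    case (Cut i \<alpha>)
    then have \<alpha>: "\<alpha> \<in> {0..1}" using q by (simp add: query_ok_def)
    have "players_cdf F i (\<tau> i (players f i) \<alpha>) = players_cdf G i (\<tau> i (players g i) \<alpha>)"
      using cut_answer(2)[OF \<tau> h \<alpha>] cut_answer(2)[OF \<tau> g \<alpha>] by simp
    then show ?thesis
      using players_windows_separated[OF narrow g] cut_answer(1)[OF \<tau> h \<alpha>]
        cut_answer(1)[OF \<tau> g \<alpha>] \<alpha> Cut by auto
  next
    case (Eval i y)
    then show ?thesis using windows_disjoint[OF narrow g] q by (auto simp: query_ok_def)
  qed
  then show thesis using that[OF narrow sub(1)] that[OF g sub(2)] shift(2) by blast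
qed

section \<open>Playing the adversary against a protocol\<close>

lemma reaches_transfer:
  assumes "reaches \<tau> P v h" "\<And>q a. (q, a) \<in> set h \<Longrightarrow> a = answer \<tau> v q \<Longrightarrow> answer \<tau> w q = a"
  shows "reaches \<tau> P w h"
  using assms
proof (induction rule: reaches.induct)
  case start
  show ?case by (rule reaches.start)
next
  case (ask h q)
  then have "reaches \<tau> P w h" by simp
  moreover have "answer \<tau> w q = answer \<tau> v q" using ask.prems by simp
  ultimately show ?case using reaches.ask[of \<tau> P w h q] ask.hyps(2) by simp
qed

lemma reaches_length_le_execution:
  assumes "reaches \<tau> P v h" "execution \<tau> P v k A"
  shows "length h \<le> length k"
proof -
  have "\<exists>g. k = h @ g"
    using assms(1)
  proof (induction rule: reaches.induct)
    case (ask h q)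
    then obtain g where g: "k = h @ g" by blast
    then have "g \<noteq> []" using ask.hyps assms(2) by (auto simp: execution_def)
    with reaches_append[of \<tau> P v h g] g assms(2) ask.hyps(2)
    have "hd g = (q, answer \<tau> v q)" by (auto simp: execution_def)
    with g \<open>g \<noteq> []\<close> have "k = (h @ [(q, answer \<tau> v q)]) @ tl g" by (cases g) auto
    then show ?case by blast
  qed simp
  then show ?thesis by auto
qed

lemma adversary:
  fixes \<tau> :: "3 cut_rule"
  assumes \<tau>: "valid_cut_rule \<tau>" and P: "rw_protocol \<tau> P" and e: "0 < \<epsilon>" "\<epsilon> \<le> 1/10000"
    and ef: "\<And>v h A. (\<forall>i. value_density (v i)) \<Longrightarrow> execution \<tau> P v h A \<Longrightarrow>
      connected_allocation A \<and> envy_free_upto \<epsilon> v A"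
    and n: "3 * \<epsilon> \<le> 1/48 / 15 ^ n"
  shows "\<exists>f F c h. hidden f F c (1/48 / 15 ^ n) \<and> reaches \<tau> P (players f) h \<and> length h = n \<and>
    (\<forall>a\<in>set h. avoids (window c (1/48 / 15 ^ n)) a)"
  using n
proof (induction n)
  case 0
  then show ?case using hidden_initial reaches.start by fastforce
next
  case (Suc n)
  define r :: real where "r = 1/48 / 15 ^ n"
  have r: "3 * \<epsilon> \<le> r" "1/48 / 15 ^ Suc n = r / 15"
    using Suc.prems e(1) by (auto simp: r_def)
  obtain f F c h where h: "hidden f F c r" and reach: "reaches \<tau> P (players f) h" "length h = n"
    and av: "\<forall>a\<in>set h. avoids (window c r) a"
    using Suc.IH r(1) unfolding r_def by blast
  have dens: "\<forall>i. value_density (players f i)"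
    using has_cdf_value_density[OF has_cdf_players[OF h]] by blast
  have cut: "x \<in> {0..1} - window c r" if "x \<in> cut_points h" for x
    using that av unfolding cut_points_def by fastforce
  show ?case
  proof (cases "P h")
    \<comment> \<open>Stopping now is impossible: near envy-freeness puts a boundary point into the
      window, but the discovered cut points and 0 and 1 all lie outside.\<close>
    case (Output A)
    then have ex: "execution \<tau> P (players f) h A" using reach(1) by (simp add: execution_def)
    obtain h' A' where "execution \<tau> P (players f) h' A'" "demarcated h' A'"
      using P dens unfolding rw_protocol_def by blast
    then have dem: "demarcated h A" using execution_unique[OF ex] by blast
    obtain i x where x: "x \<in> frontier (A i)" "x \<in> window c r"
      using hidden_not_envy_free[OF h e r(1)] ef[OF dens ex] by blast
    then have "x \<in> {0, 1}" using dem cut unfolding demarcated_def by blast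
    moreover have "0 \<notin> window c r" "1 \<notin> window c r"
      using hiddenD(2,3)[OF h] unfolding window_def by auto
    ultimately show ?thesis using x(2) by blast
  next
    case (Ask q)
    then have legal: "legal_query h q" using P dens reach(1) unfolding rw_protocol_def by blast
    then have "query_ok q" using cut by (cases q) (auto simp: query_ok_def)
    then obtain g G c' where g: "hidden g G c' (r / 15)" and sub: "window c' (r / 15) \<subseteq> window c r"
      and eq: "\<And>x. r \<le> \<bar>x - c\<bar> \<Longrightarrow> G x = F x"
      and q: "avoids (window c' (r / 15)) (q, answer \<tau> (players g) q)"
      using adversary_step[OF \<tau> h] by blast
    \<comment> \<open>\<open>G\<close> departs from \<open>F\<close> only inside the old window,
      which the whole history avoids.\<close>
    have "reaches \<tau> P (players g) h"
    proof (rule reaches_transfer[OF reach(1)])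
      fix p a assume "(p, a) \<in> set h" "a = answer \<tau> (players f) p"
      with av show "answer \<tau> (players g) p = a"
        using answer_cong[OF \<tau> h g eq, of p] by auto
    qed
    then have "reaches \<tau> P (players g) (h @ [(q, answer \<tau> (players g) q)])"
      using Ask by (rule reaches.ask)
    moreover have "avoids (window c' (r / 15)) a" if "a \<in> set h" for a
    proof -
      have "avoids (window c r) a" using av that by blast
      then show ?thesis using sub by (cases "(window c r, a)" rule: avoids.cases) auto
    qed
    ultimately show ?thesis
      unfolding r(2) using g q reach(2)
      by (intro exI[of _ g] exI[of _ G] exI[of _ c'] exI[of _ "h @ [(q, answer \<tau> (players g) q)]"]) auto
  qed
qed

theorem theorem4p2:
  shows "\<exists>c::real. c > 0 \<and> (\<exists>\<epsilon>\<^sub>0::real. 0 < \<epsilon>\<^sub>0 \<and> \<epsilon>\<^sub>0 < 1 \<and>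
    (\<forall>\<epsilon>::real. 0 < \<epsilon> \<and> \<epsilon> < \<epsilon>\<^sub>0 \<longrightarrow>
      (\<forall>(\<tau> :: 3 cut_rule) (P :: 3 protocol).
        valid_cut_rule \<tau> \<and> rw_protocol \<tau> P \<and>
        (\<forall>v h A. (\<forall>i. value_density (v i)) \<and> execution \<tau> P v h A \<longrightarrow>
            connected_allocation A \<and> envy_free_upto \<epsilon> v A) \<longrightarrow>
        (\<exists>v h A. (\<forall>i. value_density (v i)) \<and> execution \<tau> P v h A \<and>
            c * ln (1 / \<epsilon>) \<le> real (length h)))))"
proof (rule exI[of _ "1 / (2 * ln 15)"], rule conjI[OF _ exI[of _ "1 / 15 ^ 6"]], simp,
    intro conjI allI impI)
  fix \<epsilon> :: real and \<tau> :: "3 cut_rule" and P :: "3 protocol"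
  assume e: "0 < \<epsilon> \<and> \<epsilon> < 1 / 15 ^ 6"
    and P: "valid_cut_rule \<tau> \<and> rw_protocol \<tau> P \<and>
        (\<forall>v h A. (\<forall>i. value_density (v i)) \<and> execution \<tau> P v h A \<longrightarrow>
            connected_allocation A \<and> envy_free_upto \<epsilon> v A)"
  define L where "L = ln (1 / \<epsilon>) / ln 15"
  \<comment> \<open>\<open>L\<close> is the logarithm of \<open>1 / \<epsilon>\<close> to base 15.
    The adversary needs \<open>144 * 15 ^ n \<le> 1 / \<epsilon>\<close>, and 144 is below
    \<open>15 ^ 2\<close>, hence the 2. Rounding down costs at most one more, and
    \<open>6 \<le> L\<close> makes \<open>L - 3\<close> at least \<open>L / 2\<close>.\<close>
  define n where "n = nat \<lfloor>L - 2\<rfloor>"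
  have ln15: "0 < ln (15::real)" by simp
  have inv: "1 / \<epsilon> = 15 powr L" using e by (simp add: L_def powr_def)
  have "15 powr 6 \<le> 15 powr L"
    using e unfolding inv[symmetric] by (simp add: field_simps)
  then have L: "6 \<le> L" by (subst (asm) powr_le_cancel_iff) simp_all
  then have n: "L - 3 \<le> real n" "real n \<le> L - 2" unfolding n_def by linarith+
  have "15 ^ n * (225::real) = 15 powr (real n + 2)" by (simp add: powr_add powr_realpow)
  also have "\<dots> \<le> 1 / \<epsilon>" unfolding inv using n by simp
  finally have "3 * \<epsilon> \<le> 1/48 / 15 ^ n" using e by (simp add: field_simps)
  then obtain f F c h where h: "hidden f F c (1/48 / 15 ^ n)"
    and reach: "reaches \<tau> P (players f) h" "length h = n"
    using adversary[of \<tau> P \<epsilon> n] P e by auto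
  have dens: "\<forall>i. value_density (players f i)"
    using has_cdf_value_density[OF has_cdf_players[OF h]] by blast
  then obtain k A where k: "execution \<tau> P (players f) k A"
    using P unfolding rw_protocol_def by blast
  have "1 / (2 * ln 15) * ln (1 / \<epsilon>) = L / 2" by (simp add: L_def)
  also have "\<dots> \<le> real n" using n L by simp
  also have "\<dots> \<le> real (length k)"
    using reaches_length_le_execution[OF reach(1) k] reach(2) by simp
  finally show "\<exists>v h A. (\<forall>i. value_density (v i)) \<and> execution \<tau> P v h A \<and>
      1 / (2 * ln 15) * ln (1 / \<epsilon>) \<le> real (length h)"
    using dens k by blast
qed auto

end
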